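(* The ring $D_q$ of $q$-differential operators on $R=\Bbbk[x]$ is a domain (i.e. a possibly noncommutative ring without zero divisors).
   Context: Let $q$ be transcendental over $\mathbb{Q}$, let $\Bbbk$ be a field containing $\mathbb{Q}(q)$, and let $R=\Bbbk[x]$ be $\mathbb{Z}$-graded by $\deg x^a=a$, with bicharacter $\beta(n,m)=q^{nm}$ on $\mathbb{Z}$. A $\Bbbk$-linear endomorphism $\varphi$ of $R$ is homogeneous of degree $d\in\mathbb{Z}$ if $\varphi(R_b)\subseteq R_{b+d}$ for all $b\in\mathbb Z$, where $R_b=\Bbbk x^b$ for $b\ge0$ and $R_b=0$ for $b<0$. $\mathrm{grHom}_\Bbbk(R,R)$ is the space of finite sums of homogeneous endomorphisms. Each $r\in R$ is identified with the operator of multiplication by $r$; $\mathrm{grHom}_\Bbbk(R,R)$ is an $R$-bimodule via composition. For $a\in\mathbb{Z}$ put $\widetilde\sigma_a(\psi)=q^{ad}\psi$ for $\psi$ homogeneous of degree $d$ (extended linearly), and $[\varphi,\psi]_a=\varphi\psi-\widetilde\sigma_a(\psi)\varphi$. $q$-differential operators: $D_q^0$ is the smallest $R$-sub-bimodule of $\mathrm{grHom}_\Bbbk(R,R)$ containing all homogeneous $\varphi$ for which there is $a\in\mathbb{Z}$ with $[\varphi,r]_a=0$ for all $r\in R$. Inductively, $D_q^{n+1}$ is the smallest $R$-sub-bimodule containing all homogeneous $\varphi$ for which there is $a\in\mathbb{Z}$ with $[\varphi,r]_a\in D_q^n$ for all $r\in R$. Put $D_q=\bigcup_{n\ge 0}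 D_q^n$; it is a ring under composition. *)

theory Defs
  imports "HOL-Computational_Algebra.Polynomial" "HOL-Algebra.Ring"
begin

definition gr_part :: "int \<Rightarrow> 'k::field poly set" where
  "gr_part b = (if b \<ge> 0 then range (\<lambda>c. monom c (nat b)) else {0})"

definition homogeneous :: "int \<Rightarrow> ('k::field poly \<Rightarrow> 'k poly) \<Rightarrow> bool" where
  "homogeneous d \<phi> \<longleftrightarrow>
     Vector_Spaces.linear smult smult \<phi> \<and> (\<forall>b. \<phi> ` gr_part b \<subseteq> gr_part (b + d))"

definition grHom :: "('k::field poly \<Rightarrow> 'k poly) set" where
  "grHom = {\<lambda>p. \<Sum>\<psi>\<in>S. \<psi> p | S. finite S \<and> (\<forall>\<psi>\<in>S. \<exists>d. homogeneous d \<psi>)}"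

definition gr_proj :: "int \<Rightarrow> 'k::field poly \<Rightarrow> 'k poly" where
  "gr_proj b p = (if b \<ge> 0 then monom (coeff p (nat b)) (nat b) else 0)"

text \<open>The degree \<open>d\<close> homogeneous component of an operator.\<close>
definition hcomp :: "int \<Rightarrow> ('k::field poly \<Rightarrow> 'k poly) \<Rightarrow> 'k poly \<Rightarrow> 'k poly" where
  "hcomp d \<phi> p = (\<Sum>n\<le>degree p. gr_proj (int n + d) (\<phi> (gr_proj (int n) p)))"

text \<open>
  The map \<open>\<sigma>\<^sub>a\<close>, which multiplies the degree \<open>d\<close> component by \<open>q\<^sup>a\<^sup>d\<close>.  The index set
  is finite for operators in \<^const>\<open>grHom\<close>, the only ones to which it is applied. The lemmas
  \<open>twist_homogeneous\<close> and \<open>twist_add\<close> below show that this is the linear extension of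
  \<open>\<psi> \<mapsto> q\<^sup>a\<^sup>d \<psi>\<close> for \<open>\<psi>\<close> homogeneous of degree \<open>d\<close>.
\<close>
definition twist :: "'k::field \<Rightarrow> int \<Rightarrow> ('k poly \<Rightarrow> 'k poly) \<Rightarrow> 'k poly \<Rightarrow> 'k poly" where
  "twist q a \<phi> p = (\<Sum>d | hcomp d \<phi> \<noteq> (\<lambda>_. 0). smult (q powi (a * d)) (hcomp d \<phi> p))"

definition qcomm ::
  "'k::field \<Rightarrow> int \<Rightarrow> ('k poly \<Rightarrow> 'k poly) \<Rightarrow> ('k poly \<Rightarrow> 'k poly) \<Rightarrow> 'k poly \<Rightarrow> 'k poly" where
  "qcomm q a \<phi> \<psi> p = \<phi> (\<psi> p) - twist q a \<psi> (\<phi> p)"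

definition mult_op :: "'k::field poly \<Rightarrow> 'k poly \<Rightarrow> 'k poly" where
  "mult_op r = (\<lambda>p. r * p)"

definition sub_bimodule :: "('k::field poly \<Rightarrow> 'k poly) set \<Rightarrow> bool" where
  "sub_bimodule M \<longleftrightarrow> M \<subseteq> grHom \<and> (\<lambda>_. 0) \<in> M \<and>
     (\<forall>\<phi>\<in>M. \<forall>\<psi>\<in>M. (\<lambda>p. \<phi> p + \<psi> p) \<in> M) \<and>
     (\<forall>r. \<forall>\<phi>\<in>M. mult_op r \<circ> \<phi> \<in> M \<and> \<phi> \<circ> mult_op r \<in> M)"

primrec qdiff_ops_upto :: "'k::field \<Rightarrow> nat \<Rightarrow> ('k poly \<Rightarrow> 'k poly) set" where
  "qdiff_ops_upto q 0 =
     sub_bimodule hull {\<phi>. (\<exists>d. homogeneous d \<phi>) \<and>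
       (\<exists>a. \<forall>r. qcomm q a \<phi> (mult_op r) = (\<lambda>_. 0))}"
| "qdiff_ops_upto q (Suc n) =
     sub_bimodule hull {\<phi>. (\<exists>d. homogeneous d \<phi>) \<and>
       (\<exists>a. \<forall>r. qcomm q a \<phi> (mult_op r) \<in> qdiff_ops_upto q n)}"

definition qdiff_ops :: "'k::field \<Rightarrow> ('k poly \<Rightarrow> 'k poly) set" where
  "qdiff_ops q = (\<Union>n. qdiff_ops_upto q n)"

definition qdiff_ring :: "'k::field \<Rightarrow> ('k poly \<Rightarrow> 'k poly) ring" where
  "qdiff_ring q = \<lparr>carrier = qdiff_ops q, mult = (\<circ>), one = id,
     zero = (\<lambda>_. 0), add = (\<lambda>\<phi> \<psi> p. \<phi> p + \<psi> p)\<rparr>"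

text \<open>The locale \<^locale>\<open>domain\<close> requires commutativity.\<close>
definition noncomm_domain :: "('a, 'm) ring_scheme \<Rightarrow> bool" where
  "noncomm_domain A \<longleftrightarrow> ring A \<and> \<one>\<^bsub>A\<^esub> \<noteq> \<zero>\<^bsub>A\<^esub> \<and>
     (\<forall>a\<in>carrier A. \<forall>b\<in>carrier A. a \<otimes>\<^bsub>A\<^esub> b = \<zero>\<^bsub>A\<^esub> \<longrightarrow> a = \<zero>\<^bsub>A\<^esub> \<or> b = \<zero>\<^bsub>A\<^esub>)"

lemma gr_proj_homogeneous:
  assumes "homogeneous e \<phi>"
  shows "gr_proj (int n + d) (\<phi> (gr_proj (int n) p)) = (if d = e then \<phi> (gr_proj (int n) p) else 0)"
proof -
  have "gr_proj (int n) p \<in> gr_part (int n)"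
    by (auto simp: gr_proj_def gr_part_def)
  then have "\<phi> (gr_proj (int n) p) \<in> gr_part (int n + e)"
    using assms unfolding homogeneous_def by blast
  then show ?thesis
    by (auto simp: gr_part_def gr_proj_def nat_eq_iff split: if_splits)
qed

lemma gr_proj_add: "gr_proj b (p + r) = gr_proj b p + gr_proj b r"
  by (simp add: gr_proj_def add_monom)

lemma linear_sum_gr_proj:
  assumes "Vector_Spaces.linear smult smult \<phi>"
  shows "(\<Sum>n\<le>degree p. \<phi> (gr_proj (int n) p)) = \<phi> p"
proof -
  interpret Vector_Spaces.linear smult smult \<phi> by fact
  show ?thesis
    unfolding sum[symmetric] by (simp add: gr_proj_def poly_as_sum_of_monoms)
qed

lemma hcomp_homogeneous:
  assumes "homogeneous e \<phi>"
  shows "hcomp d \<phi> = (if d = e then \<phi> else (\<lambda>_. 0))"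
  using linear_sum_gr_proj[of \<phi>] assms
  by (auto simp: fun_eq_iff hcomp_def gr_proj_homogeneous[OF assms] homogeneous_def)

lemma hcomp_add: "hcomp d (\<lambda>p. \<phi> p + \<psi> p) = (\<lambda>p. hcomp d \<phi> p + hcomp d \<psi> p)"
  by (simp add: fun_eq_iff hcomp_def gr_proj_add sum.distrib)

lemma hcomp_sum:
  fixes S :: "('a::field poly \<Rightarrow> 'a poly) set"
  shows "finite S \<Longrightarrow> hcomp d (\<lambda>p. \<Sum>\<psi>\<in>S. \<psi> p) = (\<lambda>p. \<Sum>\<psi>\<in>S. hcomp d \<psi> p)"
proof (induction S rule: finite_induct)
  case empty
  have "gr_proj b (0 :: 'a poly) = 0" for b
    by (simp add: gr_proj_def)
  then show ?case by (simp add: fun_eq_iff hcomp_def)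
qed (simp add: hcomp_add)

lemma finite_hcomp:
  assumes "\<phi> \<in> grHom"
  shows "finite {d. hcomp d \<phi> \<noteq> (\<lambda>_. 0)}"
proof -
  obtain S where S: "finite S" "\<forall>\<psi>\<in>S. \<exists>d. homogeneous d \<psi>" "\<phi> = (\<lambda>p. \<Sum>\<psi>\<in>S. \<psi> p)"
    using assms by (auto simp: grHom_def)
  then obtain deg where deg: "\<forall>\<psi>\<in>S. homogeneous (deg \<psi>) \<psi>"
    by metis
  have "hcomp d \<phi> = (\<lambda>_. 0)" if "d \<notin> deg ` S" for d
  proof -
    have "hcomp d \<psi> = (\<lambda>_. 0)" if "\<psi> \<in> S" for \<psi>
      using deg that \<open>d \<notin> deg ` S\<close> hcomp_homogeneous[of "deg \<psi>" \<psi> d] by auto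
    then show ?thesis
      unfolding S(3) hcomp_sum[OF S(1)] by (simp add: fun_eq_iff)
  qed
  then have "{d. hcomp d \<phi> \<noteq> (\<lambda>_. 0)} \<subseteq> deg ` S"
    by blast
  then show ?thesis
    using S(1) finite_subset by blast
qed

lemma twist_homogeneous:
  assumes "homogeneous d \<phi>"
  shows "twist q a \<phi> = (\<lambda>p. smult (q powi (a * d)) (\<phi> p))"
proof (cases "\<phi> = (\<lambda>_. 0)")
  case False
  then have "{d. hcomp d \<phi> \<noteq> (\<lambda>_. 0)} = {d}"
    by (auto simp: hcomp_homogeneous[OF assms])
  then show ?thesis
    by (simp add: fun_eq_iff twist_def hcomp_homogeneous[OF assms])
qed (simp add: fun_eq_iff twist_def hcomp_homogeneous[OF assms])

lemma twist_add:
  assumes "\<phi> \<in> grHom" "\<psi> \<in> grHom"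
  shows "twist q a (\<lambda>p. \<phi> p + \<psi> p) = (\<lambda>p. twist q a \<phi> p + twist q a \<psi> p)"
proof
  fix p
  define D where "D = {d. hcomp d \<phi> \<noteq> (\<lambda>_. 0)} \<union> {d. hcomp d \<psi> \<noteq> (\<lambda>_. 0)}"
  have fin: "finite D"
    using assms by (simp add: D_def finite_hcomp)
  have eq: "twist q a \<chi> p = (\<Sum>d\<in>D. smult (q powi (a * d)) (hcomp d \<chi> p))"
    if "{d. hcomp d \<chi> \<noteq> (\<lambda>_. 0)} \<subseteq> D" for \<chi>
    unfolding twist_def using that fin by (intro sum.mono_neutral_left) auto
  have "{d. hcomp d (\<lambda>p. \<phi> p + \<psi> p) \<noteq> (\<lambda>_. 0)} \<subseteq> D"
    by (auto simp: D_def hcomp_add)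
  then show "twist q a (\<lambda>p. \<phi> p + \<psi> p) p = twist q a \<phi> p + twist q a \<psi> p"
    using eq[of \<phi>] eq[of \<psi>] eq[of "\<lambda>p. \<phi> p + \<psi> p"]
    by (auto simp: D_def hcomp_add smult_add_right sum.distrib)
qed

end

theory Submission imports Defs begin

text \<open>
  Write an operator \<open>\<phi>\<close> on \<open>k[x]\<close> through its symbols: \<open>f\<^sub>d(n)\<close> is the coefficient of
  \<open>x\<^bsup>n+d\<^esup>\<close> in \<open>\<phi>(x\<^sup>n)\<close>.  If \<open>\<phi>\<close> and \<open>\<psi>\<close> have top nonzero symbols \<open>f\<close> and \<open>g\<close>, of
  degrees \<open>d\<close> and \<open>e\<close>, then the symbol of \<open>\<phi> \<circ> \<psi>\<close> in degree \<open>d + e\<close> is \<open>n \<mapsto> f(n + e) g(n)\<close>.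
  So zero divisors are excluded as soon as the symbols that occur form a class of sequences in
  which such a product vanishes only if a factor does.  Arbitrary sequences do not have this
  property, but exponential polynomials, i.e. sequences \<open>F(q\<^sup>n, n)\<close> with
  \<open>F \<in> k[n][T, T\<^bsup>-1\<^esup>]\<close>, do: their ring is a domain, because \<open>F\<close> is determined by its
  values at the points \<open>(q\<^sup>n, n)\<close> when \<open>k\<close> has characteristic zero and the powers of \<open>q\<close> are
  distinct (\<open>eval2_eq_0\<close>).

  Every symbol of a \<open>q\<close>-differential operator is an exponential polynomial
  (\<open>qdiff_ops_expops\<close>).  The twisted commutator of \<open>\<phi>\<close> with \<open>x\<close> has the symbols
  \<open>f\<^sub>d(n + 1) - q\<^sup>a f\<^sub>d(n)\<close>, so along the filtration by order this amounts to solving a first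
  order difference equation inside the exponential polynomials (\<open>expoly_recurrence\<close>).

  That the operators form a ring at all rests on the twisted Leibniz rule
  \<open>[\<phi>\<psi>, r]\<^bsub>a+b\<^esub> = \<phi> [\<psi>, r]\<^sub>b + [\<phi>, \<sigma>\<^sub>b(r)]\<^sub>a \<psi>\<close> (\<open>qcomm_comp\<close>), which shows by induction that
  the order is subadditive under composition (\<open>qlevel_comp\<close>).
\<close>

section \<open>Graded endomorphisms of the polynomial ring\<close>

abbreviation lin :: "('k::field poly \<Rightarrow> 'k poly) \<Rightarrow> bool" where
  "lin \<equiv> Vector_Spaces.linear smult smult"

lemma lin_iff:
  "lin (\<phi> :: 'k::field poly \<Rightarrow> 'k poly) \<longleftrightarrow>
     (\<forall>p r. \<phi> (p + r) = \<phi> p + \<phi> r) \<and> (\<forall>c p. \<phi> (smult c p) = smult c (\<phi> p))"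
proof -
  have "vector_space (smult :: 'k \<Rightarrow> 'k poly \<Rightarrow> 'k poly)"
    by unfold_locales (auto simp: smult_add_left smult_add_right)
  then show ?thesis
    by (simp add: Vector_Spaces.linear_iff)
qed

lemma lin_add: "lin \<phi> \<Longrightarrow> \<phi> (p + r) = \<phi> p + \<phi> r"
  and lin_smult: "lin \<phi> \<Longrightarrow> \<phi> (smult c p) = smult c (\<phi> p)"
  by (simp_all add: lin_iff)

lemma lin_0: "lin \<phi> \<Longrightarrow> \<phi> 0 = 0"
  using lin_smult[of \<phi> 0 0] by simp

lemma lin_diff: "lin \<phi> \<Longrightarrow> \<phi> (p - r) = \<phi> p - \<phi> r"
  using lin_add[of \<phi> "p - r" r] by simp

lemma lin_sum: "lin \<phi> \<Longrightarrow> \<phi> (\<Sum>i\<in>A. f i) = (\<Sum>i\<in>A. \<phi> (f i))"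
  by (induction A rule: infinite_finite_induct) (simp_all add: lin_add lin_0)

lemma lin_monom: "lin \<phi> \<Longrightarrow> \<phi> (monom c n) = smult c (\<phi> (monom 1 n))"
  using lin_smult[of \<phi> c "monom 1 n"] by (simp add: smult_monom)

lemma lin_expand: "lin \<phi> \<Longrightarrow> \<phi> p = (\<Sum>n\<le>degree p. smult (coeff p n) (\<phi> (monom 1 n)))"
  using lin_sum[of \<phi> "\<lambda>n. monom (coeff p n) n" "{..degree p}"]
  by (simp add: poly_as_sum_of_monoms lin_monom[of \<phi> "coeff p _"])

lemma lin_eqI:
  assumes "lin \<phi>" "lin \<psi>" "\<And>n. \<phi> (monom 1 n) = \<psi> (monom 1 n)"
  shows "\<phi> = \<psi>"
proof
  fix p
  show "\<phi> p = \<psi> p"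
    by (simp only: lin_expand[OF assms(1), of p] lin_expand[OF assms(2), of p] assms(3))
qed

lemma homogeneous_iff:
  "homogeneous d \<phi> \<longleftrightarrow>
     lin \<phi> \<and> (\<forall>n i. coeff (\<phi> (monom 1 n)) i \<noteq> 0 \<longrightarrow> int i = int n + d)"
proof safe
  assume h: "homogeneous d \<phi>"
  then show "lin \<phi>"
    by (simp add: homogeneous_def)
  fix n i
  assume nz: "coeff (\<phi> (monom 1 n)) i \<noteq> 0"
  have "monom 1 n \<in> gr_part (int n)"
    by (auto simp: gr_part_def)
  then have "\<phi> (monom 1 n) \<in> gr_part (int n + d)"
    using h unfolding homogeneous_def by blast
  then show "int i = int n + d"
    using nz by (auto simp: gr_part_def split: if_splits)
next
  assume l: "lin \<phi>" and c: "\<forall>n i. coeff (\<phi> (monom 1 n)) i \<noteq> 0 \<longrightarrow> int i = int n + d"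
  have zero: "0 \<in> gr_part b" for b
    by (auto simp: gr_part_def image_iff intro!: exI[of _ 0])
  have "\<phi> p \<in> gr_part (b + d)" if p: "p \<in> gr_part b" for p b
  proof (cases "b \<ge> 0")
    case True
    then obtain a where a: "p = monom a (nat b)"
      using p by (auto simp: gr_part_def)
    define u where "u = \<phi> (monom 1 (nat b))"
    have u: "coeff u i \<noteq> 0 \<Longrightarrow> int i = b + d" for i
      using c True unfolding u_def by fastforce
    have "\<phi> p = smult a u"
      by (simp add: a u_def lin_monom[OF l, of a])
    moreover have "u \<in> gr_part (b + d)"
    proof (cases "b + d \<ge> 0")
      case True
      then have "u = monom (coeff u (nat (b + d))) (nat (b + d))"
        using u by (intro poly_eqI) force
      with True show ?thesis
        by (auto simp: gr_part_def)
    next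
      case False
      then have "u = 0"
        using u by (intro poly_eqI) force
      with zero show ?thesis
        by simp
    qed
    ultimately show ?thesis
      by (auto simp: gr_part_def smult_monom split: if_splits)
  next
    case False
    then show ?thesis
      using p zero lin_0[OF l] by (auto simp: gr_part_def)
  qed
  then show "homogeneous d \<phi>"
    using l by (auto simp: homogeneous_def)
qed

lemma smult_sum_right: "smult c (\<Sum>i\<in>A. f i) = (\<Sum>i\<in>A. smult c (f i))"
  by (induction A rule: infinite_finite_induct) (simp_all add: smult_add_right)

text \<open>
  Membership in \<^const>\<open>grHom\<close> asks for a decomposition into homogeneous pieces.  Since the piece
  of degree \<open>d\<close> is forced to be \<^term>\<open>hcomp d \<phi>\<close>, this is the same as a bound on the
  degrees that occur, and a bound is what behaves well under sums and compositions.
\<close>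

definition banded :: "nat \<Rightarrow> ('k::field poly \<Rightarrow> 'k poly) \<Rightarrow> bool" where
  "banded N \<phi> \<longleftrightarrow> (\<forall>n i. coeff (\<phi> (monom 1 n)) i \<noteq> 0 \<longrightarrow> \<bar>int i - int n\<bar> \<le> int N)"

lemma hcomp_eq_sum:
  assumes "lin \<phi>" "degree p \<le> m"
  shows "hcomp d \<phi> p = (\<Sum>n\<le>m. gr_proj (int n + d) (\<phi> (gr_proj (int n) p)))"
proof -
  have "gr_proj (int n + d) (\<phi> (gr_proj (int n) p)) = 0" if "n > degree p" for n
    using that lin_0[OF assms(1)] by (simp add: gr_proj_def coeff_eq_0)
  then show ?thesis
    unfolding hcomp_def using assms(2) by (intro sum.mono_neutral_left) auto
qed

lemma hcomp_monom:
  assumes "lin \<phi>"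
  shows "hcomp d \<phi> (monom 1 n) = gr_proj (int n + d) (\<phi> (monom 1 n))"
proof -
  have "hcomp d \<phi> (monom 1 n) =
      (\<Sum>m\<le>n. gr_proj (int m + d) (\<phi> (gr_proj (int m) (monom 1 n))))"
    by (rule hcomp_eq_sum[OF assms degree_monom_le])
  also have "\<dots> = (\<Sum>m\<le>n. if m = n then gr_proj (int n + d) (\<phi> (monom 1 n)) else 0)"
    by (intro sum.cong) (auto simp: gr_proj_def lin_0[OF assms])
  finally show ?thesis
    by simp
qed

lemma lin_hcomp:
  fixes \<phi> :: "'k::field poly \<Rightarrow> 'k poly"
  assumes "lin \<phi>"
  shows "lin (hcomp d \<phi>)"
  unfolding lin_iff
proof safe
  fix p r :: "'k poly" and c :: 'k
  define m where "m = max (degree p) (degree r)"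
  have "degree (p + r) \<le> m"
    by (simp add: m_def degree_add_le)
  then show "hcomp d \<phi> (p + r) = hcomp d \<phi> p + hcomp d \<phi> r"
    using assms by (simp add: hcomp_eq_sum[where m = m] m_def gr_proj_add lin_add sum.distrib)
  have *: "gr_proj b (smult c u) = smult c (gr_proj b u)" for b u
    by (simp add: gr_proj_def smult_monom)
  show "hcomp d \<phi> (smult c p) = smult c (hcomp d \<phi> p)"
    using assms hcomp_eq_sum[of \<phi> "smult c p" "degree p" d]
    by (simp add: hcomp_def[of d \<phi> p] * lin_smult smult_sum_right)
qed

lemma homogeneous_hcomp: "lin \<phi> \<Longrightarrow> homogeneous d (hcomp d \<phi>)"
  by (auto simp: homogeneous_iff lin_hcomp hcomp_monom gr_proj_def split: if_splits)

lemma lin_sum_ops: "(\<And>i. i \<in> A \<Longrightarrow> lin (f i)) \<Longrightarrow> lin (\<lambda>p. \<Sum>i\<in>A. f i p)"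
  by (simp add: lin_iff sum.distrib smult_sum_right)

lemma grHom_iff: "\<phi> \<in> grHom \<longleftrightarrow> lin \<phi> \<and> (\<exists>N. banded N \<phi>)"
proof safe
  assume "\<phi> \<in> grHom"
  then obtain S where S: "finite S" "\<forall>\<psi>\<in>S. \<exists>d. homogeneous d \<psi>" "\<phi> = (\<lambda>p. \<Sum>\<psi>\<in>S. \<psi> p)"
    by (auto simp: grHom_def)
  obtain deg where deg: "\<And>\<psi>. \<psi> \<in> S \<Longrightarrow> homogeneous (deg \<psi>) \<psi>"
    using S(2) by metis
  show "lin \<phi>"
    unfolding S(3) using deg by (intro lin_sum_ops) (auto simp: homogeneous_iff)
  define N where "N = (\<Sum>\<psi>\<in>S. nat \<bar>deg \<psi>\<bar>)"
  have "\<bar>int i - int n\<bar> \<le> int N" if nz: "coeff (\<phi> (monom 1 n)) i \<noteq> 0" for n i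
  proof -
    obtain \<psi> where "\<psi> \<in> S" and "coeff (\<psi> (monom 1 n)) i \<noteq> 0"
      using nz unfolding S(3) coeff_sum by (meson sum.neutral)
    then have "int i = int n + deg \<psi>"
      using deg by (auto simp: homogeneous_iff)
    moreover have "nat \<bar>deg \<psi>\<bar> \<le> N"
      unfolding N_def using S(1) \<open>\<psi> \<in> S\<close> by (intro member_le_sum) auto
    ultimately show ?thesis
      by linarith
  qed
  then show "\<exists>N. banded N \<phi>"
    by (auto simp: banded_def)
next
  fix N
  assume l: "lin \<phi>" and b: "banded N \<phi>"
  define D where "D = {d \<in> {- int N..int N}. hcomp d \<phi> \<noteq> (\<lambda>_. 0)}"
  have fin: "finite D"
    unfolding D_def by (rule finite_subset[of _ "{- int N..int N}"]) auto
  \<comment> \<open>\<^const>\<open>grHom\<close> sums over a set of operators; no summand is lost, because nonzero components of different degrees are different operators.\<close>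
  have inj: "inj_on (\<lambda>d. hcomp d \<phi>) D"
  proof (rule inj_onI)
    fix d e
    assume "d \<in> D" "e \<in> D" and eq: "hcomp d \<phi> = hcomp e \<phi>"
    have "hcomp d (hcomp d \<phi>) = hcomp d \<phi>"
      by (simp add: hcomp_homogeneous[OF homogeneous_hcomp[OF l]])
    moreover have "hcomp d (hcomp e \<phi>) = (if d = e then hcomp e \<phi> else (\<lambda>_. 0))"
      by (rule hcomp_homogeneous[OF homogeneous_hcomp[OF l]])
    ultimately show "d = e"
      using eq \<open>d \<in> D\<close> by (auto simp: D_def split: if_splits)
  qed
  have "\<phi> = (\<lambda>p. \<Sum>d\<in>{- int N..int N}. hcomp d \<phi> p)"
  proof (rule lin_eqI[OF l])
    show "lin (\<lambda>p. \<Sum>d\<in>{- int N..int N}. hcomp d \<phi> p)"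
      by (intro lin_sum_ops lin_hcomp l)
    fix n
    have "coeff (\<phi> (monom 1 n)) i = (\<Sum>d\<in>{- int N..int N}. coeff (hcomp d \<phi> (monom 1 n)) i)" for i
    proof -
      have "coeff (hcomp d \<phi> (monom 1 n)) i =
          (if d = int i - int n then coeff (\<phi> (monom 1 n)) i else 0)" for d
        by (auto simp: hcomp_monom[OF l] gr_proj_def)
      moreover have "coeff (\<phi> (monom 1 n)) i = 0" if "int i - int n \<notin> {- int N..int N}"
        using b that unfolding banded_def by fastforce
      ultimately show ?thesis
        by auto
    qed
    then show "\<phi> (monom 1 n) = (\<Sum>d\<in>{- int N..int N}. hcomp d \<phi> (monom 1 n))"
      by (intro poly_eqI) (simp add: coeff_sum)
  qed
  also have "\<dots> = (\<lambda>p. \<Sum>d\<in>D. hcomp d \<phi> p)"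
    by (intro ext sum.mono_neutral_right) (auto simp: D_def)
  also have "\<dots> = (\<lambda>p. \<Sum>\<psi>\<in>(\<lambda>d. hcomp d \<phi>) ` D. \<psi> p)"
    by (simp add: sum.reindex[OF inj])
  finally show "\<phi> \<in> grHom"
    unfolding grHom_def using homogeneous_hcomp[OF l] fin
    by (intro CollectI exI[of _ "(\<lambda>d. hcomp d \<phi>) ` D"]) auto
qed

lemma grHom_lin: "\<phi> \<in> grHom \<Longrightarrow> lin \<phi>"
  by (simp add: grHom_iff)

lemma homogeneous_grHom: "homogeneous d \<phi> \<Longrightarrow> \<phi> \<in> grHom"
  by (auto simp: grHom_iff homogeneous_iff banded_def intro!: exI[of _ "nat \<bar>d\<bar>"])

lemma grHom_zero: "(\<lambda>_. 0) \<in> grHom"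
  by (auto simp: grHom_iff lin_iff banded_def)

lemma grHom_add:
  assumes "\<phi> \<in> grHom" "\<psi> \<in> grHom"
  shows "(\<lambda>p. \<phi> p + \<psi> p) \<in> grHom"
proof -
  obtain N M where "banded N \<phi>" "banded M \<psi>"
    using assms by (auto simp: grHom_iff)
  then have "banded (max N M) (\<lambda>p. \<phi> p + \<psi> p)"
    unfolding banded_def by (smt (verit) add_0 coeff_add max.cobounded1 max.cobounded2 of_nat_le_iff)
  with assms show ?thesis
    by (auto simp: grHom_iff lin_iff algebra_simps smult_add_right)
qed

lemma grHom_comp:
  assumes "\<phi> \<in> grHom" "\<psi> \<in> grHom"
  shows "\<phi> \<circ> \<psi> \<in> grHom"
proof -
  obtain N M where N: "banded N \<phi>" and M: "banded M \<psi>"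
    using assms by (auto simp: grHom_iff)
  note l = grHom_lin[OF assms(1)]
  have "banded (N + M) (\<phi> \<circ> \<psi>)"
    unfolding banded_def
  proof safe
    fix n i
    assume "coeff ((\<phi> \<circ> \<psi>) (monom 1 n)) i \<noteq> 0"
    then have "(\<Sum>m\<le>degree (\<psi> (monom 1 n)). coeff (\<psi> (monom 1 n)) m * coeff (\<phi> (monom 1 m)) i) \<noteq> 0"
      by (simp add: lin_expand[OF l, of "\<psi> _"] coeff_sum)
    then obtain m where "coeff (\<psi> (monom 1 n)) m \<noteq> 0" "coeff (\<phi> (monom 1 m)) i \<noteq> 0"
      by (metis (no_types, lifting) mult_eq_0_iff sum.neutral)
    then have "\<bar>int m - int n\<bar> \<le> int M" "\<bar>int i - int m\<bar> \<le> int N"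
      using N M by (auto simp: banded_def)
    then show "\<bar>int i - int n\<bar> \<le> int (N + M)"
      by linarith
  qed
  with assms show ?thesis
    by (auto simp: grHom_iff lin_iff)
qed

lemma homogeneous_comp:
  assumes "homogeneous d \<phi>" "homogeneous e \<psi>"
  shows "homogeneous (d + e) (\<phi> \<circ> \<psi>)"
  unfolding homogeneous_def
proof safe
  show "lin (\<phi> \<circ> \<psi>)"
    using assms by (simp add: homogeneous_iff lin_iff)
  fix b and p :: "'a poly"
  assume "p \<in> gr_part b"
  then have "\<psi> p \<in> gr_part (b + e)"
    using assms(2) unfolding homogeneous_def by blast
  then have "\<phi> (\<psi> p) \<in> gr_part (b + e + d)"
    using assms(1) unfolding homogeneous_def by blast
  then show "(\<phi> \<circ> \<psi>) p \<in> gr_part (b + (d + e))"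
    by (simp add: algebra_simps)
qed

lemma lin_mult_op: "lin (mult_op r)"
  by (simp add: lin_iff mult_op_def distrib_left)

lemma homogeneous_mult_monom: "homogeneous (int k) (mult_op (monom c k))"
  unfolding homogeneous_iff
  by (intro conjI lin_mult_op) (simp add: mult_op_def mult_monom)

lemma mult_op_sum_monoms:
  "mult_op r = (\<lambda>p. \<Sum>i\<le>degree r. mult_op (monom (coeff r i) i) p)"
proof
  fix p
  have "mult_op r p = (\<Sum>i\<le>degree r. monom (coeff r i) i) * p"
    by (simp add: mult_op_def poly_as_sum_of_monoms)
  then show "mult_op r p = (\<Sum>i\<le>degree r. mult_op (monom (coeff r i) i) p)"
    by (simp only: mult_op_def sum_distrib_right)
qed

lemma grHom_sum: "(\<And>i. i \<in> A \<Longrightarrow> f i \<in> grHom) \<Longrightarrow> (\<lambda>p. \<Sum>i\<in>A. f i p) \<in> grHom"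
proof (induction A rule: infinite_finite_induct)
  case (insert i A)
  have "f i \<in> grHom" "(\<lambda>p. \<Sum>i\<in>A. f i p) \<in> grHom"
    using insert by blast+
  from grHom_add[OF this] show ?case
    by (simp only: sum.insert[OF insert.hyps])
qed (simp_all add: grHom_zero)

lemma grHom_mult_op: "mult_op r \<in> grHom"
proof -
  have "(\<lambda>p. \<Sum>i\<le>degree r. mult_op (monom (coeff r i) i) p) \<in> grHom"
    by (rule grHom_sum) (rule homogeneous_grHom[OF homogeneous_mult_monom])
  then show ?thesis
    by (simp only: mult_op_sum_monoms[of r, symmetric])
qed

lemma sub_bimodule_zero: "sub_bimodule {\<lambda>_. 0}"
  unfolding sub_bimodule_def
  by (simp add: grHom_zero) (simp add: fun_eq_iff mult_op_def)

section \<open>Twisted commutators with multiplication operators\<close>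

text \<open>
  The twist of multiplication by \<open>r\<close> is multiplication by \<open>r(q\<^sup>a x)\<close>.  In this
  form two twists compose like substitutions.
\<close>

definition dilate :: "'k::field \<Rightarrow> int \<Rightarrow> 'k poly \<Rightarrow> 'k poly" where
  "dilate q a r = pcompose r [:0, q powi a:]"

lemma twist_zero: "twist q a (\<lambda>_. 0) = (\<lambda>_. 0)"
proof -
  have "homogeneous 0 (\<lambda>_. 0 :: 'a poly)"
    by (simp add: homogeneous_iff lin_iff)
  from twist_homogeneous[OF this] show ?thesis
    by simp
qed

lemma twist_sum:
  "(\<And>i. i \<in> A \<Longrightarrow> f i \<in> grHom) \<Longrightarrow>
     twist q a (\<lambda>p. \<Sum>i\<in>A. f i p) = (\<lambda>p. \<Sum>i\<in>A. twist q a (f i) p)"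
proof (induction A rule: infinite_finite_induct)
  case (insert i A)
  show ?case
    using insert twist_add[of "f i" "\<lambda>p. \<Sum>i\<in>A. f i p" q a] by (simp add: grHom_sum)
qed (simp_all add: twist_zero)

lemma twist_mult_op:
  "twist q a (mult_op r) = mult_op (dilate q a r)"
proof -
  have "twist q a (mult_op r) =
      (\<lambda>p. \<Sum>i\<le>degree r. twist q a (mult_op (monom (coeff r i) i)) p)"
    using twist_sum[of "{..degree r}" "\<lambda>i. mult_op (monom (coeff r i) i)"]
    by (simp add: grHom_mult_op flip: mult_op_sum_monoms)
  also have "\<dots> = (\<lambda>p. \<Sum>i\<le>degree r. monom (q powi (a * int i) * coeff r i) i * p)"
    by (simp add: twist_homogeneous[OF homogeneous_mult_monom])
      (simp add: mult_op_def flip: smult_monom)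
  also have "\<dots> = mult_op (\<Sum>i\<le>degree r. monom (q powi (a * int i) * coeff r i) i)"
    by (simp add: mult_op_def sum_distrib_right)
  also have "(\<Sum>i\<le>degree r. monom (q powi (a * int i) * coeff r i) i) = dilate q a r"
    by (rule poly_eqI)
      (auto simp: coeff_sum dilate_def coeff_pcompose_linear power_int_mult coeff_eq_0)
  finally show ?thesis .
qed

lemma qcomm_mult_op:
  "qcomm q a \<phi> (mult_op r) = (\<lambda>p. \<phi> (r * p) - dilate q a r * \<phi> p)"
  unfolding qcomm_def twist_mult_op by (simp add: mult_op_def)

lemma dilate_dilate:
  assumes "q \<noteq> 0"
  shows "dilate q a (dilate q b r) = dilate q (a + b) r"
  using assms
  by (intro poly_eqI)
    (simp add: dilate_def coeff_pcompose_linear power_int_add power_mult_distrib)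

lemma dilate_0: "dilate q 0 r = r"
  by (simp add: dilate_def)

section \<open>The filtration by order and its multiplicativity\<close>

inductive_set op_sums :: "('k::field poly \<Rightarrow> 'k poly) set \<Rightarrow> ('k poly \<Rightarrow> 'k poly) set"
  for A where
  zero: "(\<lambda>_. 0) \<in> op_sums A"
| step: "\<phi> \<in> A \<Longrightarrow> \<psi> \<in> op_sums A \<Longrightarrow> (\<lambda>p. \<phi> p + \<psi> p) \<in> op_sums A"

lemma op_sums_base: "\<phi> \<in> A \<Longrightarrow> \<phi> \<in> op_sums A"
  using op_sums.step[OF _ op_sums.zero, of \<phi> A] by simp

lemma op_sums_add: "\<phi> \<in> op_sums A \<Longrightarrow> \<psi> \<in> op_sums A \<Longrightarrow> (\<lambda>p. \<phi> p + \<psi> p) \<in> op_sums A"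
proof (induction rule: op_sums.induct)
  case (step \<phi>1 \<phi>2)
  then show ?case
    using op_sums.step[of \<phi>1 A "\<lambda>p. \<phi>2 p + \<psi> p"] by (simp add: add.assoc)
qed simp

lemma op_sums_sum:
  "(\<And>i. i \<in> I \<Longrightarrow> f i \<in> op_sums A) \<Longrightarrow> (\<lambda>p. \<Sum>i\<in>I. f i p) \<in> op_sums A"
proof (induction I rule: infinite_finite_induct)
  case (insert i I)
  have "f i \<in> op_sums A" "(\<lambda>p. \<Sum>i\<in>I. f i p) \<in> op_sums A"
    using insert by blast+
  from op_sums_add[OF this] show ?case
    by (simp only: sum.insert[OF insert.hyps])
qed (simp_all add: op_sums.zero)

lemma op_sums_mono: "A \<subseteq> B \<Longrightarrow> op_sums A \<subseteq> op_sums B"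
proof
  fix \<phi>
  assume AB: "A \<subseteq> B" and "\<phi> \<in> op_sums A"
  from this(2) show "\<phi> \<in> op_sums B"
    by induction (use AB in \<open>auto intro: op_sums.intros\<close>)
qed

lemma op_sums_subset:
  assumes "sub_bimodule M" "A \<subseteq> M"
  shows "op_sums A \<subseteq> M"
proof
  fix \<phi>
  assume "\<phi> \<in> op_sums A"
  then show "\<phi> \<in> M"
    by induction (use assms in \<open>auto simp: sub_bimodule_def\<close>)
qed

text \<open>
  Both clauses of the recursion that defines the filtration have the same shape once the zero module
  is put below order 0: the operators of each order are generated by the homogeneous operators
  whose twisted commutators lie one step further down.
\<close>

definition qgens :: "'k::field \<Rightarrow> ('k poly \<Rightarrow> 'k poly) set \<Rightarrow> ('k poly \<Rightarrow> 'k poly) set" where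
  "qgens q M = {\<phi>. (\<exists>d. homogeneous d \<phi>) \<and> (\<exists>a. \<forall>r. qcomm q a \<phi> (mult_op r) \<in> M)}"

lemma qgens_grHom: "qgens q M \<subseteq> grHom"
  by (auto simp: qgens_def homogeneous_grHom)

lemma qgens_mono: "M \<subseteq> M' \<Longrightarrow> qgens q M \<subseteq> qgens q M'"
  unfolding qgens_def by blast

lemma sub_bimoduleD:
  assumes "sub_bimodule M"
  shows "\<phi> \<in> M \<Longrightarrow> \<phi> \<in> grHom" "(\<lambda>_. 0) \<in> M"
    "\<phi> \<in> M \<Longrightarrow> \<psi> \<in> M \<Longrightarrow> (\<lambda>p. \<phi> p + \<psi> p) \<in> M"
    "\<phi> \<in> M \<Longrightarrow> mult_op r \<circ> \<phi> \<in> M" "\<phi> \<in> M \<Longrightarrow> \<phi> \<circ> mult_op r \<in> M"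
  using assms by (auto simp: sub_bimodule_def)

text \<open>
  Multiplication by a monomial on either side commutes with forming the twisted commutator, because
  \<open>k[x]\<close> is commutative.  A general polynomial would destroy homogeneity.
\<close>

lemma qgens_mult_monom:
  assumes M: "sub_bimodule M" and "\<phi> \<in> qgens q M"
  shows "mult_op (monom c k) \<circ> \<phi> \<in> qgens q M"
    and "\<phi> \<circ> mult_op (monom c k) \<in> qgens q M"
proof -
  define s where "s = monom c k"
  obtain d a where h: "homogeneous d \<phi>" and a: "\<And>r. qcomm q a \<phi> (mult_op r) \<in> M"
    using assms(2) by (auto simp: qgens_def)
  have s: "homogeneous (int k) (mult_op s)"
    unfolding s_def by (rule homogeneous_mult_monom)
  have "qcomm q a (mult_op s \<circ> \<phi>) (mult_op r) = mult_op s \<circ> qcomm q a \<phi> (mult_op r)" for r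
    unfolding qcomm_mult_op by (simp add: fun_eq_iff mult_op_def algebra_simps)
  then have "qcomm q a (mult_op s \<circ> \<phi>) (mult_op r) \<in> M" for r
    using sub_bimoduleD(4)[OF M a] by simp
  then show "mult_op (monom c k) \<circ> \<phi> \<in> qgens q M"
    unfolding qgens_def using homogeneous_comp[OF s h] by (auto simp: s_def)
  have "qcomm q a (\<phi> \<circ> mult_op s) (mult_op r) = qcomm q a \<phi> (mult_op r) \<circ> mult_op s" for r
    unfolding qcomm_mult_op by (simp add: fun_eq_iff mult_op_def mult.left_commute)
  then have "qcomm q a (\<phi> \<circ> mult_op s) (mult_op r) \<in> M" for r
    using sub_bimoduleD(5)[OF M a] by simp
  then show "\<phi> \<circ> mult_op (monom c k) \<in> qgens q M"
    unfolding qgens_def using homogeneous_comp[OF h s] by (auto simp: s_def)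
qed

lemma sub_bimodule_op_sums_qgens:
  assumes M: "sub_bimodule M"
  shows "sub_bimodule (op_sums (qgens q M))"
proof -
  let ?G = "qgens q M"
  have gr: "\<phi> \<in> grHom" if "\<phi> \<in> op_sums ?G" for \<phi>
    using that
  proof induction
    case (step \<phi> \<psi>)
    then show ?case
      using grHom_add qgens_grHom by blast
  qed (rule grHom_zero)
  have left: "mult_op r \<circ> \<phi> \<in> op_sums ?G" if "\<phi> \<in> op_sums ?G" for r \<phi>
    using that
  proof induction
    case zero
    then show ?case
      using op_sums.zero by (simp add: o_def mult_op_def)
  next
    case (step \<phi> \<psi>)
    have "(\<lambda>p. \<Sum>i\<le>degree r. (mult_op (monom (coeff r i) i) \<circ> \<phi>) p) \<in> op_sums ?G"
      by (intro op_sums_sum op_sums_base qgens_mult_monom(1)[OF M] step)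
    then have "mult_op r \<circ> \<phi> \<in> op_sums ?G"
      by (simp add: o_def fun_cong[OF mult_op_sum_monoms[of r]])
    from op_sums_add[OF this step(3)] show ?case
      by (simp add: o_def mult_op_def distrib_left)
  qed
  have right: "\<phi> \<circ> mult_op r \<in> op_sums ?G" if "\<phi> \<in> op_sums ?G" for r \<phi>
    using that
  proof induction
    case zero
    then show ?case
      using op_sums.zero by (simp add: o_def)
  next
    case (step \<phi> \<psi>)
    have l: "lin \<phi>"
      using step(1) qgens_grHom grHom_lin by blast
    have "(\<lambda>p. \<Sum>i\<le>degree r. (\<phi> \<circ> mult_op (monom (coeff r i) i)) p) \<in> op_sums ?G"
      by (intro op_sums_sum op_sums_base qgens_mult_monom(2)[OF M] step)
    then have "\<phi> \<circ> mult_op r \<in> op_sums ?G"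
      by (simp add: o_def fun_cong[OF mult_op_sum_monoms[of r]] lin_sum[OF l])
    from op_sums_add[OF this step(3)] show ?case
      by (simp add: o_def)
  qed
  show ?thesis
    unfolding sub_bimodule_def using gr left right op_sums.zero op_sums_add by blast
qed

text \<open>
  Since the generators are stable under multiplication by monomials, the generated bimodule consists
  of plain sums of generators.  Statements about the filtration thus reduce to generators by
  additivity alone.
\<close>

lemma hull_qgens:
  assumes "sub_bimodule M"
  shows "sub_bimodule hull qgens q M = op_sums (qgens q M)"
  using assms by (intro hull_unique sub_bimodule_op_sums_qgens op_sums_subset)
    (auto intro: op_sums_base)

text \<open>
  The filtration with its index raised by one, so that it starts from the zero module.
\<close>

definition qlevel :: "'k::field \<Rightarrow> nat \<Rightarrow> ('k poly \<Rightarrow> 'k poly) set" where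
  "qlevel q n = (case n of 0 \<Rightarrow> {\<lambda>_. 0} | Suc m \<Rightarrow> qdiff_ops_upto q m)"

lemma qlevel_0: "qlevel q 0 = {\<lambda>_. 0}"
  by (simp add: qlevel_def)

lemma qlevel_Suc_hull: "qlevel q (Suc n) = sub_bimodule hull qgens q (qlevel q n)"
  by (cases n) (simp_all add: qlevel_def qgens_def)

lemma sub_bimodule_qlevel: "sub_bimodule (qlevel q n)"
proof (induction n)
  case (Suc n)
  then show ?case
    by (simp add: qlevel_Suc_hull hull_qgens sub_bimodule_op_sums_qgens)
qed (simp add: qlevel_0 sub_bimodule_zero)

lemma qlevel_Suc: "qlevel q (Suc n) = op_sums (qgens q (qlevel q n))"
  by (simp add: qlevel_Suc_hull hull_qgens sub_bimodule_qlevel)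

lemma qlevel_mono_Suc: "qlevel q n \<subseteq> qlevel q (Suc n)"
proof (induction n)
  case 0
  show ?case
    using sub_bimoduleD(2)[OF sub_bimodule_qlevel] by (auto simp: qlevel_0)
next
  case (Suc n)
  then show ?case
    unfolding qlevel_Suc[of q "Suc n"] qlevel_Suc[of q n]
    by (intro op_sums_mono qgens_mono) (simp add: qlevel_Suc)
qed

lemma qlevel_mono: "m \<le> n \<Longrightarrow> qlevel q m \<subseteq> qlevel q n"
  by (rule lift_Suc_mono_le[of "qlevel q"]) (rule qlevel_mono_Suc)

lemma qdiff_ops_eq: "qdiff_ops q = (\<Union>n. qlevel q n)"
proof -
  have "qdiff_ops q = (\<Union>n. qlevel q (Suc n))"
    by (simp add: qdiff_ops_def qlevel_def)
  also have "\<dots> = (\<Union>n. qlevel q n)"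
    using qlevel_mono_Suc by blast
  finally show ?thesis .
qed

lemma sub_bimodule_qdiff_ops: "sub_bimodule (qdiff_ops q)"
proof -
  have add: "(\<lambda>p. \<phi> p + \<psi> p) \<in> qdiff_ops q" if mem: "\<phi> \<in> qdiff_ops q" "\<psi> \<in> qdiff_ops q" for \<phi> \<psi>
  proof -
    obtain m n where mn: "\<phi> \<in> qlevel q m" "\<psi> \<in> qlevel q n"
      using mem by (auto simp: qdiff_ops_eq)
    have "\<phi> \<in> qlevel q (max m n)" "\<psi> \<in> qlevel q (max m n)"
      using mn qlevel_mono[of m "max m n" q] qlevel_mono[of n "max m n" q] by auto
    from sub_bimoduleD(3)[OF sub_bimodule_qlevel this] show ?thesis
      by (auto simp: qdiff_ops_eq)
  qed
  have "\<phi> \<in> grHom" "mult_op r \<circ> \<phi> \<in> qdiff_ops q" "\<phi> \<circ> mult_op r \<in> qdiff_ops q"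
    if mem: "\<phi> \<in> qdiff_ops q" for r \<phi>
  proof -
    obtain n where n: "\<phi> \<in> qlevel q n"
      using mem by (auto simp: qdiff_ops_eq)
    note D = sub_bimoduleD[OF sub_bimodule_qlevel[of q n]]
    show "\<phi> \<in> grHom" "mult_op r \<circ> \<phi> \<in> qdiff_ops q" "\<phi> \<circ> mult_op r \<in> qdiff_ops q"
      unfolding qdiff_ops_eq using D(1,4,5)[OF n] by blast+
  qed
  moreover have "(\<lambda>_. 0) \<in> qdiff_ops q"
    using qlevel_0 by (auto simp: qdiff_ops_eq)
  ultimately show ?thesis
    unfolding sub_bimodule_def using add by blast
qed

lemma id_in_qdiff_ops: "id \<in> qdiff_ops q"
proof -
  have "homogeneous 0 id"
    by (simp add: homogeneous_def lin_iff)
  moreover have "qcomm q 0 id (mult_op r) \<in> qlevel q 0" for r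
    by (simp add: qcomm_mult_op dilate_0 qlevel_0)
  ultimately have "id \<in> qlevel q (Suc 0)"
    unfolding qlevel_Suc by (intro op_sums_base) (auto simp: qgens_def)
  then show ?thesis
    by (auto simp: qdiff_ops_eq)
qed

text \<open>
  The twisted Leibniz rule: insert the term \<open>\<phi> (r(q\<^sup>b x) \<psi>(p))\<close> and take it out again.
\<close>

lemma qcomm_comp:
  assumes "q \<noteq> 0" "lin \<phi>"
  shows "qcomm q (a + b) (\<phi> \<circ> \<psi>) (mult_op r) =
    (\<lambda>p. (\<phi> \<circ> qcomm q b \<psi> (mult_op r)) p + (qcomm q a \<phi> (mult_op (dilate q b r)) \<circ> \<psi>) p)"
  by (simp add: qcomm_mult_op fun_eq_iff lin_diff[OF assms(2)] dilate_dilate[OF assms(1)])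

text \<open>
  The raised index explains the bound: levels \<open>m\<close> and \<open>n\<close> are the orders \<open>m - 1\<close> and \<open>n - 1\<close>, and
  orders add.  For generators the twisted Leibniz rule expresses each commutator of the composite
  through two compositions of smaller total level.
\<close>

lemma qlevel_comp:
  assumes q: "q \<noteq> 0"
  shows "\<phi> \<in> qlevel q m \<Longrightarrow> \<psi> \<in> qlevel q n \<Longrightarrow> \<phi> \<circ> \<psi> \<in> qlevel q (m + n - 1)"
proof (induction "m + n" arbitrary: m n \<phi> \<psi> rule: less_induct)
  case less
  note bim = sub_bimodule_qlevel[of q]
  have lin: "lin \<chi>" if "\<chi> \<in> qlevel q k" for \<chi> k
    using that sub_bimoduleD(1)[OF bim] grHom_lin by blast
  show ?case
  proof (cases "m = 0 \<or> n = 0")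
    case True
    then have "\<phi> \<circ> \<psi> = (\<lambda>_. 0)"
      using less.prems lin_0[OF lin[OF less.prems(1)]] by (auto simp: qlevel_0)
    then show ?thesis
      using sub_bimoduleD(2)[OF bim] by simp
  next
    case False
    then obtain m' n' where mn: "m = Suc m'" "n = Suc n'"
      by (meson not0_implies_Suc)
    let ?L = "qlevel q (Suc (m' + n'))"
    have gens: "\<alpha> \<circ> \<beta> \<in> ?L" if \<alpha>: "\<alpha> \<in> qgens q (qlevel q m')" and \<beta>: "\<beta> \<in> qgens q (qlevel q n')"
      for \<alpha> \<beta>
    proof -
      obtain d a where d: "homogeneous d \<alpha>"
        and a: "\<And>r. qcomm q a \<alpha> (mult_op r) \<in> qlevel q m'"
        using \<alpha> by (auto simp: qgens_def)
      obtain e b where e: "homogeneous e \<beta>"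
        and b: "\<And>r. qcomm q b \<beta> (mult_op r) \<in> qlevel q n'"
        using \<beta> by (auto simp: qgens_def)
      have in_level: "\<alpha> \<in> qlevel q m" "\<beta> \<in> qlevel q n"
        using \<alpha> \<beta> by (simp_all add: mn qlevel_Suc op_sums_base)
      have "qcomm q (a + b) (\<alpha> \<circ> \<beta>) (mult_op r) \<in> qlevel q (m' + n')" for r
      proof -
        have "\<alpha> \<circ> qcomm q b \<beta> (mult_op r) \<in> qlevel q (m' + n')"
          using less.hyps[OF _ in_level(1) b[of r]] by (simp add: mn)
        moreover have "qcomm q a \<alpha> (mult_op (dilate q b r)) \<circ> \<beta> \<in> qlevel q (m' + n')"
          using less.hyps[OF _ a[of "dilate q b r"] in_level(2)] by (simp add: mn)
        ultimately show ?thesis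
          unfolding qcomm_comp[OF q lin[OF in_level(1)]] by (rule sub_bimoduleD(3)[OF bim])
      qed
      then have "\<alpha> \<circ> \<beta> \<in> qgens q (qlevel q (m' + n'))"
        unfolding qgens_def using homogeneous_comp[OF d e] by blast
      then show ?thesis
        by (simp add: qlevel_Suc op_sums_base)
    qed
    \<comment> \<open>The general case follows by additivity, first in the right factor and then in the left.\<close>
    have right: "\<alpha> \<circ> \<psi> \<in> ?L" if \<alpha>: "\<alpha> \<in> qgens q (qlevel q m')" for \<alpha>
    proof -
      have l: "lin \<alpha>"
        using \<alpha> qgens_grHom grHom_lin by blast
      have "\<psi> \<in> op_sums (qgens q (qlevel q n'))"
        using less.prems(2) by (simp add: mn qlevel_Suc)
      then show ?thesis
      proof induction
        case zero
        then show ?case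
          using sub_bimoduleD(2)[OF bim] by (simp add: o_def lin_0[OF l])
      next
        case (step \<beta> \<chi>)
        from sub_bimoduleD(3)[OF bim gens[OF \<alpha> step(1)] step(3)] show ?case
          by (simp add: o_def lin_add[OF l])
      qed
    qed
    have "\<phi> \<in> op_sums (qgens q (qlevel q m'))"
      using less.prems(1) by (simp add: mn qlevel_Suc)
    then have "\<phi> \<circ> \<psi> \<in> ?L"
    proof induction
      case zero
      then show ?case
        using sub_bimoduleD(2)[OF bim] by (simp add: o_def)
    next
      case (step \<alpha> \<chi>)
      from sub_bimoduleD(3)[OF bim right[OF step(1)] step(3)] show ?case
        by (simp add: o_def)
    qed
    then show ?thesis
      by (simp add: mn)
  qed
qed

lemma qdiff_ops_comp:
  "q \<noteq> 0 \<Longrightarrow> \<phi> \<in> qdiff_ops q \<Longrightarrow> \<psi> \<in> qdiff_ops q \<Longrightarrow> \<phi> \<circ> \<psi> \<in> qdiff_ops q"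
  using qlevel_comp by (fastforce simp: qdiff_ops_eq)

lemma ring_qdiff_ring:
  assumes q: "q \<noteq> 0"
  shows "ring (qdiff_ring q)"
proof (intro ringI abelian_groupI monoidI)
  note D = sub_bimoduleD[OF sub_bimodule_qdiff_ops[of q]]
  note simps = qdiff_ring_def fun_eq_iff
  show "\<exists>y\<in>carrier (qdiff_ring q). y \<oplus>\<^bsub>qdiff_ring q\<^esub> \<phi> = \<zero>\<^bsub>qdiff_ring q\<^esub>"
    if "\<phi> \<in> carrier (qdiff_ring q)" for \<phi>
    using that D(4)[of \<phi> "-1"]
    by (intro bexI[of _ "mult_op (-1) \<circ> \<phi>"]) (simp_all add: simps mult_op_def)
  show "\<chi> \<otimes>\<^bsub>qdiff_ring q\<^esub> (\<phi> \<oplus>\<^bsub>qdiff_ring q\<^esub> \<psi>) =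
      \<chi> \<otimes>\<^bsub>qdiff_ring q\<^esub> \<phi> \<oplus>\<^bsub>qdiff_ring q\<^esub> \<chi> \<otimes>\<^bsub>qdiff_ring q\<^esub> \<psi>"
    if "\<chi> \<in> carrier (qdiff_ring q)" for \<phi> \<psi> \<chi>
    using that lin_add[OF grHom_lin[OF D(1)]] by (simp add: simps)
qed (use sub_bimoduleD[OF sub_bimodule_qdiff_ops[of q]] qdiff_ops_comp[OF q] id_in_qdiff_ops
      in \<open>auto simp: qdiff_ring_def fun_eq_iff add_ac\<close>)

section \<open>Exponential polynomials\<close>

text \<open>
  A polynomial in two variables is an element of \<open>k[n][T]\<close>: \<open>T\<close> is the outer variable and takes the
  values \<open>q\<^sup>n\<close>.  This ring is a domain as an iterated polynomial ring.
\<close>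

definition eval2 :: "'k::field poly poly \<Rightarrow> 'k \<Rightarrow> 'k \<Rightarrow> 'k" where
  "eval2 F t n = poly (poly F [:t:]) n"

lemma eval2_simps [simp]:
  "eval2 0 t n = 0"
  "eval2 (F + G) t n = eval2 F t n + eval2 G t n"
  "eval2 (F - G) t n = eval2 F t n - eval2 G t n"
  "eval2 (F * G) t n = eval2 F t n * eval2 G t n"
  "eval2 (smult P F) t n = poly P n * eval2 F t n"
  "eval2 (monom P i) t n = poly P n * t ^ i"
  by (simp_all add: eval2_def poly_monom poly_power)

text \<open>
  The substitution \<open>F(u T, n + c)\<close>, which translates the argument of the exponential polynomial when
  \<open>u = q\<^sup>c\<close>.
\<close>

definition shift2 :: "'k::field \<Rightarrow> 'k \<Rightarrow> 'k poly poly \<Rightarrow> 'k poly poly" where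
  "shift2 u c F = pcompose (map_poly (\<lambda>P. pcompose P [:c, 1:]) F) [:0, [:u:]:]"

lemma coeff_shift2: "coeff (shift2 u c F) i = smult (u ^ i) (pcompose (coeff F i) [:c, 1:])"
  by (simp add: shift2_def coeff_pcompose_linear coeff_map_poly poly_const_pow)

lemma eval2_shift2: "eval2 (shift2 u c F) t n = eval2 F (u * t) (n + c)"
proof -
  have "poly (poly (map_poly (\<lambda>P. pcompose P [:c, 1:]) F) [:u * t:]) n = poly (poly F [:u * t:]) (n + c)"
  proof (induction F)
    case (pCons P F)
    then show ?case
      by (simp add: map_poly_pCons poly_pcompose add.commute)
  qed simp
  then show ?thesis
    by (simp add: eval2_def shift2_def poly_pcompose mult.commute)
qed

lemma shift2_eq_0:
  assumes "u \<noteq> 0" "shift2 u c F = 0"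
  shows "F = 0"
proof (rule poly_eqI)
  fix i
  have "smult (u ^ i) (pcompose (coeff F i) [:c, 1:]) = 0"
    using assms(2) coeff_shift2[of u c F i] by simp
  then have "pcompose (coeff F i) [:c, 1:] = 0"
    using assms(1) by simp
  then have "coeff F i = 0"
    by (rule pcompose_eq_0) simp
  then show "coeff F i = coeff 0 i"
    by simp
qed

text \<open>
  Translation does not change the leading term, which is what makes differences drop the degree.
\<close>

lemma coeff_shift_poly:
  fixes P :: "'k::field poly"
  shows "degree (pcompose P [:c, 1:]) = degree P"
    and "coeff (pcompose P [:c, 1:]) (degree P) = lead_coeff P"
proof -
  show *: "degree (pcompose P [:c, 1:]) = degree P"
    by (simp add: degree_pcompose)
  show "coeff (pcompose P [:c, 1:]) (degree P) = lead_coeff P"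
    using lead_coeff_comp[of "[:c, 1:]" P] by (simp add: *)
qed

lemma degree_difference_less:
  fixes P :: "'k::field poly"
  assumes "degree P > 0"
  shows "degree (pcompose P [:c, 1:] - P) < degree P"
proof -
  let ?D = "pcompose P [:c, 1:] - P"
  have le: "degree ?D \<le> degree P"
    by (intro degree_diff_le) (simp_all add: coeff_shift_poly)
  have "coeff ?D (degree P) = 0"
    by (simp add: coeff_shift_poly)
  then show ?thesis
    using le assms by (metis degree_0 leading_coeff_0_iff le_neq_implies_less)
qed

text \<open>
  Evaluation along \<open>n \<mapsto> (q\<^sup>n, n)\<close> is injective: passing from \<open>F(T, n)\<close> to
  \<open>F(q T, n + 1) - q\<^sup>d F(T, n)\<close>, with \<open>d\<close> the degree in \<open>T\<close>, keeps the vanishing but lowers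
  the degree of the leading coefficient (or \<open>d\<close>, if that coefficient is constant).  By induction
  the new polynomial is zero, and this leaves only \<open>F = P(n) T\<^sup>d\<close>, where \<open>P\<close> vanishes at all natural
  numbers.
\<close>

lemma eval2_eq_0:
  fixes q :: "'k::field_char_0"
  assumes q: "q \<noteq> 0" "\<And>i j. i < j \<Longrightarrow> q ^ i \<noteq> q ^ j"
  shows "(\<And>n. eval2 F (q ^ n) (of_nat n) = 0) \<Longrightarrow> F = 0"
proof (induction "(degree F, degree (lead_coeff F))" arbitrary: F
    rule: wf_induct_rule[OF wf_lex_prod[OF wf_less_than wf_less_than]])
  case (1 F)
  define d where "d = degree F"
  define P where "P = lead_coeff F"
  define G where "G = shift2 q 1 F - smult [:q ^ d:] F"
  have cG: "coeff G i = smult (q ^ i) (pcompose (coeff F i) [:1, 1:]) - smult (q ^ d) (coeff F i)" for i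
    by (simp add: G_def coeff_shift2)
  have cGd: "coeff G d = smult (q ^ d) (pcompose P [:1, 1:] - P)"
    by (simp add: cG d_def P_def smult_diff_right)
  have degG: "degree G \<le> d"
    by (rule degree_le) (simp add: cG d_def coeff_eq_0)
  \<comment> \<open>\<open>G\<close> evaluates to the difference \<open>F(q\<^bsup>n+1\<^esup>, n + 1) - q\<^sup>d F(q\<^sup>n, n)\<close>.\<close>
  have vanish: "eval2 G (q ^ n) (of_nat n) = 0" for n
    using 1(2)[of n] 1(2)[of "Suc n"] by (simp add: G_def eval2_shift2 add.commute)
  have "G = 0"
  proof (rule ccontr)
    assume "G \<noteq> 0"
    have "((degree G, degree (lead_coeff G)), (degree F, degree (lead_coeff F))) \<in> less_than <*lex*> less_than"
    proof (cases "degree G = d")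
      case True
      then have "coeff G d \<noteq> 0"
        using \<open>G \<noteq> 0\<close> by auto
      then have "degree P > 0"
        by (metis cGd degree_eq_zeroE diff_self gr0I pcompose_const smult_0_right)
      then have "degree (coeff G d) < degree P"
        using degree_difference_less[of P 1] q(1) by (simp add: cGd)
      then show ?thesis
        using True by (simp add: d_def P_def)
    next
      case False
      then show ?thesis
        using degG by (simp add: d_def)
    qed
    with 1(1) vanish have "G = 0"
      by blast
    with \<open>G \<noteq> 0\<close> show False ..
  qed
  \<comment> \<open>Below the top, \<open>G = 0\<close> forces \<open>(q\<^sup>i - q\<^sup>d) c = 0\<close> for the leading coefficient \<open>c\<close> of each term.\<close>
  have low: "coeff F i = 0" if "i < d" for i
  proof (rule ccontr)
    assume "coeff F i \<noteq> 0"
    have "coeff (coeff G i) (degree (coeff F i)) = (q ^ i - q ^ d) * lead_coeff (coeff F i)"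
      by (simp add: cG coeff_shift_poly algebra_simps)
    then show False
      using \<open>G = 0\<close> q(2)[OF that] \<open>coeff F i \<noteq> 0\<close> by simp
  qed
  then have F: "F = monom P d"
    by (intro poly_eqI) (metis coeff_eq_0 coeff_monom d_def P_def linorder_neqE_nat)
  \<comment> \<open>The remaining factor vanishes at all natural numbers, hence at infinitely many points.\<close>
  have "poly P (of_nat n) = 0" for n :: nat
    using 1(2)[of n] q(1) by (simp add: F)
  then have "range (of_nat :: nat \<Rightarrow> 'k) \<subseteq> {x. poly P x = 0}"
    by blast
  then have "P = 0"
    using poly_roots_finite[of P] infinite_super[OF _ range_inj_infinite[OF inj_of_nat]] by blast
  then show "F = 0"
    by (simp add: F)
qed

text \<open>
  The subleading binomial coefficient of \<open>(x + 1)\<^bsup>m+1\<^esup>\<close>.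
\<close>

lemma coeff_shift_power:
  "coeff (pcompose (monom 1 (Suc m)) [:1, 1:]) m = (of_nat (Suc m) :: 'a::comm_ring_1)"
proof -
  have top: "coeff (pcompose (monom 1 n) [:1, 1:]) i = (if i = n then 1 else 0 :: 'a)" if "n \<le> i" for n i
    using that
    by (induction n arbitrary: i) (auto simp: monom_Suc pcompose_pCons coeff_pCons monom_0 split: nat.splits)
  show ?thesis
  proof (induction m)
    case 0
    show ?case
      by (simp add: monom_Suc[of 1 0] pcompose_pCons monom_0)
  next
    case (Suc m)
    then show ?case
      by (simp add: monom_Suc[of 1 "Suc m"] pcompose_pCons top)
  qed
qed

text \<open>
  The operator \<open>Q \<mapsto> u Q(x + 1) - v Q(x)\<close> multiplies leading coefficients by \<open>u - v\<close> if this is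
  nonzero.  If \<open>u = v\<close> it lowers the degree by one and sends \<open>x\<^bsup>m+1\<^esup>\<close> to \<open>u (m + 1) x\<^sup>m + \<dots>\<close>, where
  \<open>m + 1\<close> is invertible in characteristic zero.  Either way any leading term can be hit, and
  induction on the degree removes the rest.
\<close>

lemma poly_difference_equation:
  fixes u v :: "'k::field_char_0"
  assumes "u \<noteq> 0"
  shows "\<exists>Q. smult u (pcompose Q [:1, 1:]) - smult v Q = P"
proof (induction "degree P" arbitrary: P rule: less_induct)
  case less
  let ?T = "\<lambda>Q. smult u (pcompose Q [:1, 1:]) - smult v Q"
  show ?case
  proof (cases "P = 0")
    case True
    then show ?thesis
      by (intro exI[of _ 0]) simp
  next
    case False
    define m where "m = degree P"
    have "\<exists>Q. degree (?T Q) \<le> m \<and> coeff (?T Q) m = lead_coeff P"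
    proof (cases "u = v")
      case False
      define Q where "Q = monom (lead_coeff P / (u - v)) m"
      have Q: "degree Q = m" "lead_coeff Q = lead_coeff P / (u - v)"
        using False \<open>P \<noteq> 0\<close> by (simp_all add: Q_def degree_monom_eq)
      have "degree (?T Q) \<le> m"
        by (intro degree_diff_le order_trans[OF degree_smult_le]) (simp_all add: coeff_shift_poly Q)
      moreover have "coeff (?T Q) m = (u - v) * lead_coeff Q"
        using coeff_shift_poly(2)[of Q 1] by (simp add: Q(1) algebra_simps)
      ultimately show ?thesis
        using False Q(2) by (intro exI[of _ Q]) auto
    next
      case True
      define E where "E = (monom 1 (Suc m) :: 'k poly)"
      define Q where "Q = smult (lead_coeff P / (u * of_nat (Suc m))) E"
      have T: "?T Q = smult (lead_coeff P / of_nat (Suc m)) (pcompose E [:1, 1:] - E)"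
        using True assms by (simp add: Q_def pcompose_smult smult_diff_right)
      have "degree (pcompose E [:1, 1:] - E) \<le> m"
        using degree_difference_less[of E 1] by (simp add: E_def degree_monom_eq)
      then have "degree (?T Q) \<le> m"
        unfolding T using degree_smult_le le_trans by blast
      moreover have "coeff (?T Q) m = lead_coeff P"
        unfolding T using coeff_shift_power[of m, where 'a = 'k]
        by (simp add: E_def del: of_nat_Suc)
      ultimately show ?thesis
        by blast
    qed
    then obtain Q where Q: "degree (?T Q) \<le> m" "coeff (?T Q) m = lead_coeff P"
      by blast
    define R where "R = P - ?T Q"
    have "\<exists>Q'. ?T Q' = R"
    proof (cases "R = 0")
      case True
      then show ?thesis
        by (intro exI[of _ 0]) simp
    next
      case False
      have "degree R \<le> m" "coeff R m = 0"
        unfolding R_def using Q by (auto simp: m_def intro!: degree_diff_le)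
      then have "degree R < degree P"
        using False by (metis leading_coeff_0_iff le_neq_implies_less m_def)
      then show ?thesis
        by (rule less)
    qed
    then obtain Q' where "?T Q' = R"
      by blast
    then have "?T (Q + Q') = P"
      by (simp add: R_def pcompose_add smult_add_right algebra_simps)
    then show ?thesis
      by blast
  qed
qed

lemma shift2_difference_equation:
  fixes u v :: "'k::field_char_0"
  assumes "u \<noteq> 0"
  shows "\<exists>F. shift2 u 1 F - smult [:v:] F = G"
proof -
  have "\<forall>i. \<exists>Q. smult (u ^ i) (pcompose Q [:1, 1:]) - smult v Q = coeff G i"
    using assms by (intro allI poly_difference_equation) simp
  then obtain f where f: "\<And>i. smult (u ^ i) (pcompose (f i) [:1, 1:]) - smult v (f i) = coeff G i"
    by metis
  define F where "F = (\<Sum>i\<le>degree G. monom (f i) i)"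
  have F: "coeff F i = (if i \<le> degree G then f i else 0)" for i
    by (simp add: F_def coeff_sum)
  have "shift2 u 1 F - smult [:v:] F = G"
    by (rule poly_eqI) (auto simp: coeff_shift2 F f coeff_eq_0)
  then show ?thesis ..
qed

text \<open>
  Negative powers of \<open>q\<^sup>n\<close> are cleared by the factor \<open>q\<^bsup>N n\<^esup>\<close>, so that \<open>F\<close> can be an honest
  polynomial.
\<close>

definition expoly :: "'k::field \<Rightarrow> (nat \<Rightarrow> 'k) \<Rightarrow> bool" where
  "expoly q s \<longleftrightarrow> (\<exists>N F. \<forall>n. q ^ (N * n) * s n = eval2 F (q ^ n) (of_nat n))"

lemma expoly_raise:
  assumes "\<And>n. q ^ (N * n) * s n = eval2 F (q ^ n) (of_nat n)"
  shows "q ^ ((N + k) * n) * s n = eval2 (F * monom 1 k) (q ^ n) (of_nat n)"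
proof -
  have "q ^ ((N + k) * n) * s n = (q ^ (N * n) * s n) * (q ^ n) ^ k"
    by (simp add: distrib_right power_add mult.commute[of k n] power_mult[of q n k])
  then show ?thesis
    by (simp add: assms)
qed

lemma expoly_zero: "expoly q (\<lambda>_. 0)"
  unfolding expoly_def by (intro exI[of _ 0]) simp

lemma expoly_add:
  assumes "expoly q s" "expoly q t"
  shows "expoly q (\<lambda>n. s n + t n)"
proof -
  obtain N F M G where s: "\<And>n. q ^ (N * n) * s n = eval2 F (q ^ n) (of_nat n)"
    and t: "\<And>n. q ^ (M * n) * t n = eval2 G (q ^ n) (of_nat n)"
    using assms unfolding expoly_def by blast
  have "q ^ ((N + M) * n) * (s n + t n) = eval2 (F * monom 1 M + G * monom 1 N) (q ^ n) (of_nat n)" for n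
    using expoly_raise[OF s, of M n] expoly_raise[OF t, of N n]
    by (simp add: distrib_left add.commute)
  then show ?thesis
    unfolding expoly_def by blast
qed

lemma expoly_scale:
  assumes "expoly q s"
  shows "expoly q (\<lambda>n. c * s n)"
proof -
  obtain N F where s: "\<And>n. q ^ (N * n) * s n = eval2 F (q ^ n) (of_nat n)"
    using assms unfolding expoly_def by blast
  have "q ^ (N * n) * (c * s n) = eval2 (smult [:c:] F) (q ^ n) (of_nat n)" for n
    using s[of n] by (simp add: mult.left_commute)
  then show ?thesis
    unfolding expoly_def by blast
qed

lemma expoly_sum: "(\<And>i. i \<in> I \<Longrightarrow> expoly q (s i)) \<Longrightarrow> expoly q (\<lambda>n. \<Sum>i\<in>I. s i n)"
  by (induction I rule: infinite_finite_induct) (simp_all add: expoly_zero expoly_add)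

lemma expoly_shift:
  assumes q: "q \<noteq> 0" and "expoly q s"
  shows "expoly q (\<lambda>n. s (n + k))"
proof -
  obtain N F where s: "\<And>n. q ^ (N * n) * s n = eval2 F (q ^ n) (of_nat n)"
    using assms unfolding expoly_def by blast
  have "q ^ (N * n) * (q ^ (N * k) * s (n + k)) = eval2 (shift2 (q ^ k) (of_nat k) F) (q ^ n) (of_nat n)" for n
    using s[of "n + k"] by (simp add: eval2_shift2 power_add distrib_left mult_ac)
  then have "expoly q (\<lambda>n. q ^ (N * k) * s (n + k))"
    unfolding expoly_def by blast
  from expoly_scale[OF this, of "inverse (q ^ (N * k))"] show ?thesis
    using q by (simp add: mult.assoc[symmetric])
qed

text \<open>
  A particular solution exists among the exponential polynomials by the preceding lemma, and two
  solutions differ by a multiple of \<open>n \<mapsto> q\<^bsup>a n\<^esup>\<close>, which is one as well.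
\<close>

lemma expoly_recurrence:
  fixes q :: "'k::field_char_0"
  assumes q: "q \<noteq> 0" and g: "expoly q (\<lambda>n. s (Suc n) - q powi a * s n)"
  shows "expoly q s"
proof -
  obtain N F where F: "\<And>n. q ^ (N * n) * (s (Suc n) - q powi a * s n) = eval2 F (q ^ n) (of_nat n)"
    using g unfolding expoly_def by blast
  \<comment> \<open>The denominator is enlarged until \<open>q\<^bsup>(M + a) n\<^esup>\<close> is a genuine power of \<open>q\<^sup>n\<close>.\<close>
  define k where "k = nat (- a)"
  define M where "M = N + k"
  define j where "j = nat (int M + a)"
  have "int j = int M + a"
    by (simp add: j_def M_def k_def)
  then have v: "q ^ M * q powi a = q ^ j"
    using q by (metis power_int_add power_int_of_nat)
  obtain H where H: "shift2 q 1 H - smult [:q ^ j:] H = smult [:q ^ M:] (F * monom 1 k)"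
    using shift2_difference_equation[OF q] by blast
  define w where "w n = q ^ (M * n) * s n - eval2 H (q ^ n) (of_nat n)" for n
  have w: "w (Suc n) = q ^ j * w n" for n
  proof -
    have "q ^ (M * Suc n) * s (Suc n) - q ^ j * (q ^ (M * n) * s n)
        = q ^ M * (q ^ (M * n) * (s (Suc n) - q powi a * s n))"
      by (simp add: v[symmetric] power_add algebra_simps)
    also have "\<dots> = q ^ M * eval2 (F * monom 1 k) (q ^ n) (of_nat n)"
      using expoly_raise[OF F, of k n] by (simp add: M_def)
    also have "\<dots> = eval2 (shift2 q 1 H - smult [:q ^ j:] H) (q ^ n) (of_nat n)"
      by (simp add: H)
    also have "\<dots> = eval2 H (q ^ Suc n) (of_nat (Suc n)) - q ^ j * eval2 H (q ^ n) (of_nat n)"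
      by (simp add: eval2_shift2 add.commute)
    finally show ?thesis
      by (simp add: w_def algebra_simps)
  qed
  have *: "w n = w 0 * (q ^ n) ^ j" for n
    by (induction n) (simp_all add: w power_mult_distrib)
  have "q ^ (M * n) * s n = eval2 (H + monom [:w 0:] j) (q ^ n) (of_nat n)" for n
    using *[of n] unfolding w_def[of n] by (simp add: diff_eq_eq add.commute)
  then show ?thesis
    unfolding expoly_def by blast
qed

section \<open>Symbols of q-differential operators\<close>

text \<open>
  The value is zero where \<open>x\<^bsup>n+d\<^esup>\<close> does not exist.  This is forced by the grading, and it is what
  keeps the difference equation for symbols valid at the boundary \<open>n + d = - 1\<close>.
\<close>

definition symbol :: "int \<Rightarrow> ('k::field poly \<Rightarrow> 'k poly) \<Rightarrow> nat \<Rightarrow> 'k" where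
  "symbol d \<phi> n = (if int n + d \<ge> 0 then coeff (\<phi> (monom 1 n)) (nat (int n + d)) else 0)"

lemma coeff_eq_symbol: "coeff (\<phi> (monom 1 n)) m = symbol (int m - int n) \<phi> n"
  by (simp add: symbol_def)

lemma symbol_zero: "symbol d (\<lambda>_. 0) = (\<lambda>_. 0)"
  by (simp add: symbol_def fun_eq_iff)

lemma symbol_add: "symbol d (\<lambda>p. \<phi> p + \<psi> p) = (\<lambda>n. symbol d \<phi> n + symbol d \<psi> n)"
  by (simp add: symbol_def fun_eq_iff)

lemma symbol_mult_left:
  "symbol d (mult_op r \<circ> \<phi>) n = (\<Sum>i\<le>degree r. coeff r i * symbol (d - int i) \<phi> n)"
proof (cases "int n + d \<ge> 0")
  case True
  define m where "m = nat (int n + d)"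
  have d: "d = int m - int n"
    using True by (simp add: m_def)
  have "coeff (monom c i * \<phi> (monom 1 n)) m = c * symbol (d - int i) \<phi> n" for c i
    by (simp add: coeff_monom_mult symbol_def d nat_diff_distrib)
  moreover have "(mult_op r \<circ> \<phi>) (monom 1 n)
      = (\<Sum>i\<le>degree r. monom (coeff r i) i * \<phi> (monom 1 n))"
    using fun_cong[OF mult_op_sum_monoms[of r]] by (simp add: mult_op_def)
  ultimately have "coeff ((mult_op r \<circ> \<phi>) (monom 1 n)) m
      = (\<Sum>i\<le>degree r. coeff r i * symbol (d - int i) \<phi> n)"
    by (simp only: coeff_sum)
  then show ?thesis
    by (simp only: d coeff_eq_symbol[of "mult_op r \<circ> \<phi>"])
qed (simp add: symbol_def)

lemma symbol_mult_right:
  assumes "lin \<phi>"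
  shows "symbol d (\<phi> \<circ> mult_op r) n
    = (\<Sum>i\<le>degree r. coeff r i * symbol (d - int i) \<phi> (n + i))"
proof -
  have "mult_op r (monom 1 n) = (\<Sum>i\<le>degree r. monom (coeff r i) (n + i))"
    by (subst mult_op_sum_monoms) (simp add: mult_op_def mult_monom add.commute)
  then have "\<phi> (mult_op r (monom 1 n)) = (\<Sum>i\<le>degree r. smult (coeff r i) (\<phi> (monom 1 (n + i))))"
    by (simp add: lin_sum[OF assms] lin_monom[OF assms, of "coeff r _"])
  then show ?thesis
    by (simp add: symbol_def coeff_sum)
qed

definition expops :: "'k::field \<Rightarrow> ('k poly \<Rightarrow> 'k poly) set" where
  "expops q = {\<phi> \<in> grHom. \<forall>d. expoly q (symbol d \<phi>)}"

lemma sub_bimodule_expops: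
  assumes q: "q \<noteq> 0"
  shows "sub_bimodule (expops q)"
proof -
  have "mult_op r \<circ> \<phi> \<in> expops q" if "\<phi> \<in> expops q" for r \<phi>
  proof -
    have "expoly q (\<lambda>n. \<Sum>i\<le>degree r. coeff r i * symbol (d - int i) \<phi> n)" for d
      using that by (intro expoly_sum expoly_scale) (simp add: expops_def)
    then show ?thesis
      using that by (simp add: expops_def grHom_comp grHom_mult_op symbol_mult_left[abs_def])
  qed
  moreover have "\<phi> \<circ> mult_op r \<in> expops q" if "\<phi> \<in> expops q" for r \<phi>
  proof -
    have l: "lin \<phi>"
      using that grHom_lin by (auto simp: expops_def)
    have "expoly q (\<lambda>n. \<Sum>i\<le>degree r. coeff r i * symbol (d - int i) \<phi> (n + i))" for d
      using that by (intro expoly_sum expoly_scale expoly_shift q) (simp add: expops_def)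
    then show ?thesis
      using that by (simp add: expops_def grHom_comp grHom_mult_op symbol_mult_right[OF l, abs_def])
  qed
  ultimately show ?thesis
    unfolding sub_bimodule_def
    by (auto simp: expops_def grHom_zero grHom_add symbol_zero symbol_add expoly_zero expoly_add)
qed

text \<open>
  The commutator with \<open>x\<close> alone suffices: its symbol in degree \<open>e + 1\<close> is the first order difference
  of the symbol of \<open>\<phi>\<close> in degree \<open>e\<close>.
\<close>

lemma qgens_expops:
  fixes q :: "'k::field_char_0"
  assumes q: "q \<noteq> 0"
  shows "qgens q (expops q) \<subseteq> expops q"
proof
  fix \<phi>
  assume "\<phi> \<in> qgens q (expops q)"
  then obtain d a where "homogeneous d \<phi>"
    and a: "\<And>r. qcomm q a \<phi> (mult_op r) \<in> expops q"
    unfolding qgens_def by blast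
  have "expoly q (symbol e \<phi>)" for e
  proof (rule expoly_recurrence[OF q])
    have dil: "dilate q a (monom 1 (Suc 0)) = monom (q powi a) (Suc 0)"
      by (simp add: dilate_def pcompose_pCons monom_altdef)
    have "symbol (e + 1) (qcomm q a \<phi> (mult_op (monom 1 1))) n
        = symbol e \<phi> (Suc n) - q powi a * symbol e \<phi> n" for n
      by (auto simp: qcomm_mult_op dil symbol_def mult_monom coeff_monom_mult
          nat_add_distrib nat_diff_distrib add_ac)
    moreover have "expoly q (symbol (e + 1) (qcomm q a \<phi> (mult_op (monom 1 1))))"
      using a by (simp add: expops_def)
    ultimately show "expoly q (\<lambda>n. symbol e \<phi> (Suc n) - q powi a * symbol e \<phi> n)"
      by (metis (no_types, lifting) ext)
  qed
  then show "\<phi> \<in> expops q"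
    using homogeneous_grHom[OF \<open>homogeneous d \<phi>\<close>] by (simp add: expops_def)
qed

lemma qdiff_ops_expops:
  fixes q :: "'k::field_char_0"
  assumes q: "q \<noteq> 0"
  shows "qdiff_ops q \<subseteq> expops q"
proof -
  have "qlevel q n \<subseteq> expops q" for n
  proof (induction n)
    case 0
    show ?case
      using sub_bimoduleD(2)[OF sub_bimodule_expops[OF q]] by (simp add: qlevel_0)
  next
    case (Suc n)
    have "qgens q (qlevel q n) \<subseteq> expops q"
      using qgens_mono[OF Suc] qgens_expops[OF q] by (rule subset_trans)
    then show ?case
      unfolding qlevel_Suc by (rule op_sums_subset[OF sub_bimodule_expops[OF q]])
  qed
  then show ?thesis
    unfolding qdiff_ops_eq by blast
qed

section \<open>Absence of zero divisors\<close>

lemma top_symbol: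
  assumes "\<phi> \<in> grHom" "\<phi> \<noteq> (\<lambda>_. 0)"
  obtains e where "symbol e \<phi> \<noteq> (\<lambda>_. 0)" "\<And>d. d > e \<Longrightarrow> symbol d \<phi> = (\<lambda>_. 0)"
proof -
  obtain N where lin: "lin \<phi>" and N: "banded N \<phi>"
    using assms(1) by (auto simp: grHom_iff)
  define D where "D = {d. symbol d \<phi> \<noteq> (\<lambda>_. 0)}"
  have "d \<in> {- int N..int N}" if d: "d \<in> D" for d
  proof -
    obtain n where "symbol d \<phi> n \<noteq> 0"
      using d by (auto simp: D_def fun_eq_iff)
    then have "int n + d \<ge> 0" "coeff (\<phi> (monom 1 n)) (nat (int n + d)) \<noteq> 0"
      by (auto simp: symbol_def split: if_splits)
    with N have "\<bar>int (nat (int n + d)) - int n\<bar> \<le> int N"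
      unfolding banded_def by blast
    with \<open>int n + d \<ge> 0\<close> show ?thesis
      by auto
  qed
  then have fin: "finite D"
    by (meson finite_atLeastAtMost_int finite_subset subsetI)
  have "\<exists>n. \<phi> (monom 1 n) \<noteq> 0"
    using lin_eqI[OF lin, of "\<lambda>_. 0"] assms(2) by (auto simp: lin_iff)
  then obtain n where "lead_coeff (\<phi> (monom 1 n)) \<noteq> 0"
    by auto
  then have "D \<noteq> {}"
    unfolding coeff_eq_symbol D_def by (auto simp: fun_eq_iff)
  with fin have "Max D \<in> D" and "\<And>d. d > Max D \<Longrightarrow> d \<notin> D"
    using Max_ge[of D] by (auto simp: not_le[symmetric])
  moreover have "d \<in> D \<longleftrightarrow> symbol d \<phi> \<noteq> (\<lambda>_. 0)" for d
    by (simp add: D_def)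
  ultimately show thesis
    using that[of "Max D"] by blast
qed

text \<open>
  In \<open>\<phi>(\<psi>(x\<^sup>n))\<close> the highest possible power of \<open>x\<close> arises only from the highest power \<open>x\<^sup>k\<close> in
  \<open>\<psi>(x\<^sup>n)\<close>.
\<close>

lemma symbol_comp_top:
  assumes lin: "lin \<phi>"
    and \<phi>: "\<And>d. d > e \<Longrightarrow> symbol d \<phi> = (\<lambda>_. 0)"
    and \<psi>: "\<And>d. d > e' \<Longrightarrow> symbol d \<psi> = (\<lambda>_. 0)"
    and k: "int k = int n + e'"
  shows "symbol (e + e') (\<phi> \<circ> \<psi>) n = symbol e \<phi> k * symbol e' \<psi> n"
proof (cases "int k + e \<ge> 0")
  case True
  define u where "u = \<psi> (monom 1 n)"
  define j where "j = nat (int k + e)"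
  have j: "int j = int k + e"
    using True by (simp add: j_def)
  have "coeff u m * coeff (\<phi> (monom 1 m)) j = (if m = k then coeff u k * symbol e \<phi> k else 0)" for m
  proof -
    consider "m < k" | "m = k" | "m > k"
      by linarith
    then show ?thesis
    proof cases
      case 1
      then have "coeff (\<phi> (monom 1 m)) j = 0"
        using \<phi>[of "int j - int m"] j by (simp add: coeff_eq_symbol)
      with 1 show ?thesis
        by simp
    next
      case 2
      then show ?thesis
        using j by (simp add: coeff_eq_symbol[of \<phi>])
    next
      case 3
      then have "coeff u m = 0"
        using \<psi>[of "int m - int n"] k by (simp add: u_def coeff_eq_symbol)
      with 3 show ?thesis
        by simp
    qed
  qed
  then have "coeff (\<phi> u) j = (\<Sum>m\<le>degree u. if m = k then coeff u k * symbol e \<phi> k else 0)"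
    unfolding lin_expand[OF lin, of u] by (simp add: coeff_sum)
  also have "\<dots> = coeff u k * symbol e \<phi> k"
    by (simp add: coeff_eq_0)
  also have "coeff u k = symbol e' \<psi> n"
    using k by (simp add: u_def coeff_eq_symbol)
  finally have "coeff ((\<phi> \<circ> \<psi>) (monom 1 n)) j = symbol e \<phi> k * symbol e' \<psi> n"
    by (simp add: u_def)
  moreover have "int j - int n = e + e'"
    using j k by simp
  ultimately show ?thesis
    by (simp only: coeff_eq_symbol)
next
  case False
  then show ?thesis
    using k by (simp add: symbol_def)
qed

text \<open>
  The sequences are only given on natural numbers, but the polynomial behind \<open>s\<close> may be translated
  by a negative \<open>e\<close> as well.  At the finitely many \<open>n\<close> with \<open>n + e < 0\<close>, where the translate has
  lost its meaning as a value of \<open>s\<close>, the factor \<open>t\<close> vanishes; so the product of the two polynomials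
  vanishes at all points \<open>(q\<^sup>n, n)\<close>.
\<close>

lemma expoly_shifted_product_zero:
  fixes q :: "'k::field_char_0"
  assumes q: "q \<noteq> 0" "\<And>i j. i < j \<Longrightarrow> q ^ i \<noteq> q ^ j"
    and "expoly q s" "expoly q t"
    and neg: "\<And>n. int n + e < 0 \<Longrightarrow> t n = 0"
    and prod: "\<And>n k. int k = int n + e \<Longrightarrow> s k * t n = 0"
  shows "s = (\<lambda>_. 0) \<or> t = (\<lambda>_. 0)"
proof -
  obtain N F M G where s: "\<And>n. q ^ (N * n) * s n = eval2 F (q ^ n) (of_nat n)"
    and t: "\<And>n. q ^ (M * n) * t n = eval2 G (q ^ n) (of_nat n)"
    using assms(3,4) unfolding expoly_def by blast
  define H where "H = shift2 (q powi e) (of_int e) F * G"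
  have "eval2 H (q ^ n) (of_nat n) = 0" for n
  proof (cases "int n + e < 0")
    case True
    then show ?thesis
      using neg[of n] t[of n] by (simp add: H_def)
  next
    case False
    define k where "k = nat (int n + e)"
    have k: "int k = int n + e"
      using False by (simp add: k_def)
    have "q powi e * q ^ n = q ^ k"
      using q(1) k by (metis power_int_add power_int_of_nat add.commute)
    moreover have "of_nat n + of_int e = (of_nat k :: 'k)"
      using k by (metis of_int_add of_int_of_nat_eq)
    ultimately have "eval2 H (q ^ n) (of_nat n) = (q ^ (N * k) * s k) * (q ^ (M * n) * t n)"
      by (simp add: H_def eval2_shift2 s t)
    then show ?thesis
      using prod[OF k] by auto
  qed
  then have "H = 0"
    using eval2_eq_0[OF q] by blast
  then have "F = 0 \<or> G = 0"
    using shift2_eq_0[of "q powi e"] q(1) by (auto simp: H_def)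
  then show ?thesis
    using s t q(1) by (auto simp: fun_eq_iff)
qed

lemma qdiff_ops_no_zero_divisors:
  fixes q :: "'k::field_char_0"
  assumes q: "q \<noteq> 0" "\<And>i j. i < j \<Longrightarrow> q ^ i \<noteq> q ^ j"
    and "\<phi> \<in> qdiff_ops q" "\<psi> \<in> qdiff_ops q" and comp: "\<phi> \<circ> \<psi> = (\<lambda>_. 0)"
  shows "\<phi> = (\<lambda>_. 0) \<or> \<psi> = (\<lambda>_. 0)"
proof (rule ccontr)
  assume "\<not> ?thesis"
  then have nz: "\<phi> \<noteq> (\<lambda>_. 0)" "\<psi> \<noteq> (\<lambda>_. 0)"
    by auto
  have "\<phi> \<in> expops q" "\<psi> \<in> expops q"
    using assms qdiff_ops_expops[OF q(1)] by auto
  then have gr: "\<phi> \<in> grHom" "\<psi> \<in> grHom"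
    and ex: "expoly q (symbol d \<phi>)" "expoly q (symbol d \<psi>)" for d
    by (simp_all add: expops_def)
  obtain e where e: "symbol e \<phi> \<noteq> (\<lambda>_. 0)" "\<And>d. d > e \<Longrightarrow> symbol d \<phi> = (\<lambda>_. 0)"
    using top_symbol[OF gr(1) nz(1)] by blast
  obtain e' where e': "symbol e' \<psi> \<noteq> (\<lambda>_. 0)" "\<And>d. d > e' \<Longrightarrow> symbol d \<psi> = (\<lambda>_. 0)"
    using top_symbol[OF gr(2) nz(2)] by blast
  have "symbol e \<phi> k * symbol e' \<psi> n = 0" if "int k = int n + e'" for k n
    using symbol_comp_top[OF grHom_lin[OF gr(1)] e(2) e'(2) that]
    by (simp add: comp symbol_zero)
  moreover have "symbol e' \<psi> n = 0" if "int n + e' < 0" for n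
    using that by (simp add: symbol_def)
  ultimately have "symbol e \<phi> = (\<lambda>_. 0) \<or> symbol e' \<psi> = (\<lambda>_. 0)"
    by (intro expoly_shifted_product_zero[OF q ex]) auto
  with e(1) e'(1) show False
    by blast
qed

lemma power_neq_if_not_algebraic:
  fixes q :: "'k::field_char_0"
  assumes "\<not> algebraic q" "i < j"
  shows "q ^ i \<noteq> q ^ j"
proof
  assume eq: "q ^ i = q ^ j"
  define p where "p = monom 1 j - (monom 1 i :: 'k poly)"
  have "coeff p j = 1"
    using assms(2) by (simp add: p_def)
  then have "p \<noteq> 0"
    by auto
  moreover have "coeff p l \<in> \<int>" for l
    by (simp add: p_def)
  moreover have "poly p q = 0"
    by (simp add: p_def poly_monom eq)
  ultimately show False
    using assms(1) algebraicI by blast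
qed

theorem corollary3p0p1:
  fixes q :: "'k::field_char_0"
  assumes "\<not> algebraic q"
  shows "noncomm_domain (qdiff_ring q)"
proof -
  have q: "q \<noteq> 0" "\<And>i j. i < j \<Longrightarrow> q ^ i \<noteq> q ^ j"
    using power_neq_if_not_algebraic[OF assms] assms by auto
  have "id \<noteq> (\<lambda>_. 0 :: 'k poly)"
    by (metis id_apply one_neq_zero)
  then show ?thesis
    unfolding noncomm_domain_def
    using ring_qdiff_ring[OF q(1)] qdiff_ops_no_zero_divisors[OF q]
    by (simp add: qdiff_ring_def)
qed

end
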